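(* Let $v\in C^{1,1}(\mathbb{R})$ be non-decreasing and non-constant, and for $0<\varepsilon<1$ let $$x_i:=\inf\{x\in\mathbb{R}\,:\,v(x)=\varepsilon i\},\quad i=M_\varepsilon,\ldots,N_\varepsilon,\qquad M_\varepsilon:=\left\lceil\frac{\inf_{\mathbb{R}}v+\varepsilon}{\varepsilon}\right\rceil,\quad N_\varepsilon:=\left\lfloor\frac{\sup_{\mathbb{R}}v-\varepsilon}{\varepsilon}\right\rfloor.$$ Let $\delta=\delta_\varepsilon>0$ with $\delta_\varepsilon\to0$ as $\varepsilon\to0$, and let $\phi$ be the unique solution of $$\mathcal{I}_1[\phi]=W'(\phi)\ \text{in }\mathbb{R},\quad \phi'>0\ \text{in }\mathbb{R},\quad \lim_{x\to-\infty}\phi(x)=0,\quad \lim_{x\to+\infty}\phi(x)=1,\quad \phi(0)=\tfrac12.$$ Then, for all $x\in\mathbb{R}$, $$\left|\sum_{i=M_\varepsilon}^{N_\varepsilon}\varepsilon\,\phi\left(\frac{x-x_i}{\varepsilon\delta}\right)+\varepsilon M_\varepsilon-v(x)\right|\le o_\varepsilon(1),$$ where $o_\varepsilon(1)\to0$ as $\varepsilon\to0$ and $o_\varepsilon(1)$ is independent of $x$.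
   Context: $C^{1,1}(\mathbb{R})$ is the set of functions with bounded $C^{1,1}$ norm over $\mathbb{R}$. $\mathcal{I}_1[v](x)=\frac1\pi\mathrm{PV}\int_{\mathbb{R}}\frac{v(y)-v(x)}{(y-x)^2}dy$. Standing assumptions on the potential: $W\in C^{2,\beta}(\mathbb{R})$ for some $0<\beta<1$, $W(u+1)=W(u)$ for all $u$, $W=0$ on $\mathbb{Z}$, $W>0$ on $\mathbb{R}\setminus\mathbb{Z}$, $W''(0)>0$. Under these assumptions $\phi$ exists and is unique (known). *)

theory Defs
  imports "HOL-Analysis.Analysis"
begin

text \<open>Functions with finite global \<open>C\<^sup>k\<^sup>,\<^sup>\<alpha>\<close> norm on the line, for \<open>0 < \<alpha> \<le> 1\<close>.
  Continuity of the top-order derivative is implied by the Hoelder bound.\<close>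

definition Holder_space :: "nat \<Rightarrow> real \<Rightarrow> (real \<Rightarrow> real) set" where
  "Holder_space k \<alpha> = {f.
     (\<forall>j<k. (deriv ^^ j) f differentiable_on UNIV) \<and>
     (\<forall>j\<le>k. bounded (range ((deriv ^^ j) f))) \<and>
     (\<exists>C. \<forall>x y. \<bar>(deriv ^^ k) f x - (deriv ^^ k) f y\<bar> \<le> C * \<bar>x - y\<bar> powr \<alpha>)}"

text \<open>The principal value is taken at the singularity only: away from it the integrand is
  required to be absolutely integrable, as it is for every bounded measurable \<open>v\<close> below.\<close>

definition has_PV_integral :: "(real \<Rightarrow> real) \<Rightarrow> real \<Rightarrow> real \<Rightarrow> bool" where
  "has_PV_integral g x I \<longleftrightarrow>
     (\<forall>r>0. set_integrable lebesgue {y. r < \<bar>y - x\<bar>} g) \<and>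
     ((\<lambda>r. set_lebesgue_integral lebesgue {y. r < \<bar>y - x\<bar>} g) \<longlongrightarrow> I) (at_right 0)"

text \<open>\<open>has_I1 v x l\<close>: the principal value defining \<open>\<I>\<^sub>1[v](x)\<close> exists and
  \<open>\<I>\<^sub>1[v](x) = l\<close>.\<close>

definition has_I1 :: "(real \<Rightarrow> real) \<Rightarrow> real \<Rightarrow> real \<Rightarrow> bool" where
  "has_I1 v x l \<longleftrightarrow>
     (\<exists>I. has_PV_integral (\<lambda>y. (v y - v x) / (y - x)\<^sup>2) x I \<and> l = 1 / pi * I)"

definition periodic_potential :: "real \<Rightarrow> (real \<Rightarrow> real) \<Rightarrow> bool" where
  "periodic_potential \<beta> W \<longleftrightarrow>
     W \<in> Holder_space 2 \<beta> \<and>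
     (\<forall>u. W (u + 1) = W u) \<and>
     (\<forall>u\<in>\<int>. W u = 0) \<and>
     (\<forall>u. u \<notin> \<int> \<longrightarrow> W u > 0) \<and>
     deriv (deriv W) 0 > 0"

definition layer_solution :: "(real \<Rightarrow> real) \<Rightarrow> (real \<Rightarrow> real) \<Rightarrow> bool" where
  "layer_solution W \<phi> \<longleftrightarrow>
     (\<forall>x. has_I1 \<phi> x (deriv W (\<phi> x))) \<and>
     \<phi> differentiable_on UNIV \<and> (\<forall>x. deriv \<phi> x > 0) \<and>
     (\<phi> \<longlongrightarrow> 0) at_bot \<and> (\<phi> \<longlongrightarrow> 1) at_top \<and> \<phi> 0 = 1 / 2"

definition M_idx :: "(real \<Rightarrow> real) \<Rightarrow> real \<Rightarrow> int" where
  "M_idx v \<epsilon> = \<lceil>(Inf (range v) + \<epsilon>) / \<epsilon>\<rceil>"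

definition N_idx :: "(real \<Rightarrow> real) \<Rightarrow> real \<Rightarrow> int" where
  "N_idx v \<epsilon> = \<lfloor>(Sup (range v) - \<epsilon>) / \<epsilon>\<rfloor>"

text \<open>For \<open>M_idx v \<epsilon> \<le> i \<le> N_idx v \<epsilon>\<close> the level set is nonempty and bounded
  below when \<open>v\<close> is bounded, continuous and non-decreasing; other indices are never used.\<close>

definition level_pt :: "(real \<Rightarrow> real) \<Rightarrow> real \<Rightarrow> int \<Rightarrow> real" where
  "level_pt v \<epsilon> i = Inf {x. v x = \<epsilon> * of_int i}"

end

theory Submission imports Defs begin

text \<open>Each layer \<open>\<phi>((x - x\<^sub>i) / (\<epsilon>\<delta>))\<close> is a smoothed Heaviside step at \<open>x\<^sub>i\<close>. If it is
  replaced by the sharp step, the sum counts the levels \<open>\<epsilon>i\<close> that \<open>v\<close> has reached at \<open>x\<close>, so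
  \<open>\<epsilon>\<close> times the count, shifted by \<open>\<epsilon>M\<^sub>\<epsilon>\<close>, is \<open>v x\<close> rounded to the grid \<open>\<epsilon>\<int>\<close>, up to a truncation
  near \<open>inf v\<close> and \<open>sup v\<close>; the error is at most \<open>2\<epsilon>\<close> (\<open>staircase_approx\<close>).

  The cost of the replacement is split according to the distance between \<open>x\<close> and \<open>x\<^sub>i\<close>
  (\<open>profile_step_error\<close>). Where \<open>\<bar>x - x\<^sub>i\<bar> \<le> \<epsilon>\<close>, the Lipschitz bound on \<open>v\<close> gives
  \<open>\<bar>\<epsilon>i - v x\<bar> \<le> L\<epsilon>\<close>, hence there are at most \<open>2L + 1\<close> such indices, uniformly in \<open>\<epsilon>\<close> and \<open>x\<close>,
  and together they cost \<open>O(\<epsilon>)\<close>. Where \<open>\<bar>x - x\<^sub>i\<bar> > \<epsilon>\<close>, the argument of \<open>\<phi>\<close> exceeds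
  \<open>1/\<delta>\<close> in modulus, so that each term is off by at most the tail of \<open>\<phi>\<close> beyond \<open>1/\<delta>\<close>. There are at
  most \<open>(sup v - inf v)/\<epsilon>\<close> terms, each weighted by \<open>\<epsilon>\<close>, so these cost at most the oscillation of
  \<open>v\<close> times the tail, which vanishes because \<open>\<delta> \<rightarrow> 0\<close>.\<close>

section \<open>Regularity of the data\<close>

lemma Holder_space_bounded:
  assumes "f \<in> Holder_space k \<alpha>"
  shows "bounded (range f)"
proof -
  have "\<forall>j\<le>k. bounded (range ((deriv ^^ j) f))"
    using assms by (simp add: Holder_space_def)
  from this[rule_format, of 0] show ?thesis by simp
qed

lemma Holder_space_Suc_Lipschitz:
  assumes "f \<in> Holder_space (Suc k) \<alpha>"
  obtains L where "L \<ge> 0" "\<And>x y. \<bar>f x - f y\<bar> \<le> L * \<bar>x - y\<bar>"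
proof -
  have diff: "f differentiable_on UNIV" and "bounded (range (deriv f))"
  proof -
    have *: "\<forall>j<Suc k. (deriv ^^ j) f differentiable_on UNIV"
      "\<forall>j\<le>Suc k. bounded (range ((deriv ^^ j) f))"
      using assms by (simp_all add: Holder_space_def)
    from *(1)[rule_format, of 0] show "f differentiable_on UNIV" by simp
    from *(2)[rule_format, of 1] show "bounded (range (deriv f))" by simp
  qed
  then obtain L where L: "\<And>x. norm (deriv f x) \<le> L" and "L > 0"
    by (auto simp: bounded_pos)
  have "norm (f x - f y) \<le> L * norm (x - y)" for x y
  proof (rule field_differentiable_bound[of UNIV f "deriv f"])
    show "(f has_field_derivative deriv f z) (at z within UNIV)" for z
      using diff
      by (auto simp: differentiable_on_def field_differentiable_def real_differentiable_def
          DERIV_deriv_iff_field_differentiable)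
  qed (use L in auto)
  with \<open>L > 0\<close> show ?thesis by (intro that[of L]) auto
qed

lemma layer_solution_mono:
  assumes "layer_solution W \<phi>"
  shows "mono \<phi>"
proof (rule monoI)
  fix x y :: real
  assume "x \<le> y"
  then show "\<phi> x \<le> \<phi> y"
  proof (rule DERIV_nonneg_imp_nondecreasing)
    fix z
    have "(\<phi> has_field_derivative deriv \<phi> z) (at z)"
      using assms
      by (auto simp: layer_solution_def differentiable_on_def field_differentiable_def
          real_differentiable_def DERIV_deriv_iff_field_differentiable)
    moreover have "deriv \<phi> z \<ge> 0"
      using assms by (simp add: layer_solution_def less_imp_le)
    ultimately show "\<exists>D. (\<phi> has_real_derivative D) (at z) \<and> 0 \<le> D" by blast
  qed
qed

lemma mono_ge_limit_at_bot:
  fixes f :: "real \<Rightarrow> real"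
  assumes "mono f" "(f \<longlongrightarrow> l) at_bot"
  shows "l \<le> f x"
proof (rule tendsto_upperbound[OF assms(2)])
  show "\<forall>\<^sub>F y in at_bot. f y \<le> f x"
    using eventually_le_at_bot[of x] by eventually_elim (rule monoD[OF \<open>mono f\<close>])
qed simp

lemma mono_le_limit_at_top:
  fixes f :: "real \<Rightarrow> real"
  assumes "mono f" "(f \<longlongrightarrow> l) at_top"
  shows "f x \<le> l"
proof (rule tendsto_lowerbound[OF assms(2)])
  show "\<forall>\<^sub>F y in at_top. f x \<le> f y"
    using eventually_ge_at_top[of x] by eventually_elim (rule monoD[OF \<open>mono f\<close>])
qed simp

section \<open>Level points\<close>

text \<open>The level set is closed, nonempty by the intermediate value theorem, and bounded below by any
  point at which \<open>v\<close> is still below the level; so its infimum belongs to it.\<close>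

lemma level_pt_attained:
  assumes "continuous_on UNIV v" "mono v" and below: "v a < \<epsilon> * of_int i" and above: "\<epsilon> * of_int i < v b"
  shows "v (level_pt v \<epsilon> i) = \<epsilon> * of_int i"
    and "\<And>x. v x = \<epsilon> * of_int i \<Longrightarrow> level_pt v \<epsilon> i \<le> x"
proof -
  let ?S = "{x. v x = \<epsilon> * of_int i}"
  have lower: "a \<le> x" if "x \<in> ?S" for x
    using that below monoD[OF \<open>mono v\<close>, of x a] by (cases "a \<le> x") auto
  then have bdd: "bdd_below ?S" by (rule bdd_belowI)
  have "a \<le> b"
    using below above monoD[OF \<open>mono v\<close>, of b a] by (cases "a \<le> b") auto
  then obtain c where "v c = \<epsilon> * of_int i"
    using IVT'[of v a "\<epsilon> * of_int i" b] below above continuous_on_subset[OF assms(1)] by auto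
  then have "?S \<noteq> {}" by auto
  moreover have "closed ?S"
    using assms(1) by (intro closed_Collect_eq) auto
  ultimately have "Inf ?S \<in> ?S" using bdd by (intro closed_contains_Inf)
  then show "v (level_pt v \<epsilon> i) = \<epsilon> * of_int i" by (simp add: level_pt_def)
  show "level_pt v \<epsilon> i \<le> x" if "v x = \<epsilon> * of_int i" for x
    unfolding level_pt_def using that bdd by (intro cInf_lower) auto
qed

text \<open>The first point of a level tells whether the level has been reached. This is where taking the
  infimum of the level set matters: on a plateau of \<open>v\<close>, any later point of it would fail.\<close>

lemma level_pt_le_iff:
  assumes "continuous_on UNIV v" "mono v" "v a < \<epsilon> * of_int i" "\<epsilon> * of_int i < v b"
  shows "level_pt v \<epsilon> i \<le> x \<longleftrightarrow> \<epsilon> * of_int i \<le> v x"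
proof
  assume "level_pt v \<epsilon> i \<le> x"
  then show "\<epsilon> * of_int i \<le> v x"
    using monoD[OF \<open>mono v\<close>] level_pt_attained(1)[OF assms] by metis
next
  assume ge: "\<epsilon> * of_int i \<le> v x"
  show "level_pt v \<epsilon> i \<le> x"
  proof (rule ccontr)
    assume "\<not> level_pt v \<epsilon> i \<le> x"
    then have "v x \<le> v (level_pt v \<epsilon> i)" by (intro monoD[OF \<open>mono v\<close>]) simp
    with ge have "v x = \<epsilon> * of_int i" using level_pt_attained(1)[OF assms] by simp
    then show False using level_pt_attained(2)[OF assms] \<open>\<not> level_pt v \<epsilon> i \<le> x\<close> by blast
  qed
qed

lemma index_range_between:
  assumes "\<epsilon> > 0" "i \<in> {M_idx v \<epsilon>..N_idx v \<epsilon>}"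
  shows "Inf (range v) + \<epsilon> \<le> \<epsilon> * of_int i" "\<epsilon> * of_int i \<le> Sup (range v) - \<epsilon>"
  using assms
  by (auto simp: M_idx_def N_idx_def ceiling_le_iff le_floor_iff field_simps)

lemma index_range_levels_crossed:
  fixes v :: "real \<Rightarrow> real"
  assumes "\<epsilon> > 0" "i \<in> {M_idx v \<epsilon>..N_idx v \<epsilon>}"
  obtains a b where "v a < \<epsilon> * of_int i" "\<epsilon> * of_int i < v b"
proof -
  have "Inf (range v) < \<epsilon> * of_int i" "\<epsilon> * of_int i < Sup (range v)"
    using index_range_between[OF assms] \<open>\<epsilon> > 0\<close> by linarith+
  then obtain y z where "y \<in> range v" "y < \<epsilon> * of_int i" "z \<in> range v" "\<epsilon> * of_int i < z"
    using cInf_lessD[of "range v"] less_cSupD[of "range v"] by blast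
  then show ?thesis using that by blast
qed

section \<open>Counting indices\<close>

lemma weighted_card_index_range:
  assumes "\<epsilon> > 0" "bounded (range v)"
  shows "\<epsilon> * real (card {M_idx v \<epsilon>..N_idx v \<epsilon>}) \<le> Sup (range v) - Inf (range v)"
proof (cases "M_idx v \<epsilon> \<le> N_idx v \<epsilon>")
  case True
  then have "\<epsilon> * real (card {M_idx v \<epsilon>..N_idx v \<epsilon>})
      = \<epsilon> * of_int (N_idx v \<epsilon>) - \<epsilon> * of_int (M_idx v \<epsilon>) + \<epsilon>"
    by (simp add: algebra_simps)
  also have "\<dots> \<le> Sup (range v) - Inf (range v)"
    using True index_range_between[OF \<open>\<epsilon> > 0\<close>, of "M_idx v \<epsilon>" v]
      index_range_between[OF \<open>\<epsilon> > 0\<close>, of "N_idx v \<epsilon>" v] \<open>\<epsilon> > 0\<close> by auto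
  finally show ?thesis .
next
  case False
  have "Inf (range v) \<le> Sup (range v)"
    using assms(2) by (intro cInf_le_cSup) (auto simp: bounded_imp_bdd_above bounded_imp_bdd_below)
  with False show ?thesis by simp
qed

lemma card_integers_near:
  fixes t r :: real
  assumes "finite A" "r \<ge> 0" "\<And>i. i \<in> A \<Longrightarrow> \<bar>of_int i - t\<bar> \<le> r"
  shows "real (card A) \<le> 2 * r + 1"
proof -
  have "A \<subseteq> {\<lceil>t - r\<rceil>..\<lfloor>t + r\<rfloor>}"
    using assms(3) by (fastforce simp: ceiling_le_iff le_floor_iff abs_le_iff)
  then have "card A \<le> card {\<lceil>t - r\<rceil>..\<lfloor>t + r\<rfloor>}" by (intro card_mono) auto
  also have "\<dots> = nat (\<lfloor>t + r\<rfloor> - \<lceil>t - r\<rceil> + 1)" by simp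
  finally show ?thesis using \<open>r \<ge> 0\<close> by linarith
qed

text \<open>With \<open>m\<close> the largest counted index, the left-hand side inside the modulus is
  \<open>\<epsilon>(m + 1) - v x\<close>, and \<open>m\<close> is either \<open>\<lfloor>v x / \<epsilon>\<rfloor>\<close> or the cut-off \<open>N_idx v \<epsilon>\<close>, which lies less than
  \<open>2\<epsilon>\<close> below \<open>sup v\<close>. If nothing is counted, \<open>v x\<close> is trapped near \<open>inf v\<close> or the whole range of \<open>v\<close> is
  short compared with \<open>\<epsilon>\<close>; both leave it within \<open>2\<epsilon>\<close> of \<open>\<epsilon> * M_idx v \<epsilon>\<close>.\<close>

lemma staircase_approx:
  assumes "\<epsilon> > 0" "bounded (range v)"
  shows "\<bar>(\<Sum>i\<in>{M_idx v \<epsilon>..N_idx v \<epsilon>}. \<epsilon> * of_bool (\<epsilon> * of_int i \<le> v x))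
           + \<epsilon> * of_int (M_idx v \<epsilon>) - v x\<bar> \<le> 2 * \<epsilon>"
proof -
  define M N k where "M = M_idx v \<epsilon>" and "N = N_idx v \<epsilon>" and "k = \<lfloor>v x / \<epsilon>\<rfloor>"
  have range: "Inf (range v) \<le> v x" "v x \<le> Sup (range v)"
    using assms(2)
    by (auto intro!: cInf_lower cSup_upper simp: bounded_imp_bdd_above bounded_imp_bdd_below)
  have "of_int M < (Inf (range v) + \<epsilon>) / \<epsilon> + 1"
    unfolding M_def M_idx_def by linarith
  then have M: "\<epsilon> * of_int M < v x + 2 * \<epsilon>"
    using \<open>\<epsilon> > 0\<close> range by (simp add: field_simps)
  have "(Sup (range v) - \<epsilon>) / \<epsilon> < of_int N + 1"
    unfolding N_def N_idx_def by linarith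
  then have N: "v x - \<epsilon> < \<epsilon> * of_int N + \<epsilon>"
    using \<open>\<epsilon> > 0\<close> range by (simp add: field_simps)
  have "of_int k \<le> v x / \<epsilon>" "v x / \<epsilon> < of_int k + 1"
    unfolding k_def by linarith+
  then have k: "\<epsilon> * of_int k \<le> v x" "v x < \<epsilon> * of_int k + \<epsilon>"
    using \<open>\<epsilon> > 0\<close> by (simp_all add: field_simps)
  have reached: "\<epsilon> * of_int i \<le> v x \<longleftrightarrow> i \<le> k" for i
    using \<open>\<epsilon> > 0\<close> by (simp add: k_def le_floor_iff field_simps)
  have "(\<Sum>i\<in>{M..N}. \<epsilon> * of_bool (\<epsilon> * of_int i \<le> v x)) = \<epsilon> * real (card ({M..N} \<inter> {i. i \<le> k}))"
    by (simp add: reached flip: sum_distrib_left)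
  also have "{M..N} \<inter> {i. i \<le> k} = {M..min N k}" by auto
  finally have sum: "(\<Sum>i\<in>{M..N}. \<epsilon> * of_bool (\<epsilon> * of_int i \<le> v x))
    = \<epsilon> * real (card {M..min N k})" .
  have mult: "\<epsilon> * of_int i + \<epsilon> \<le> \<epsilon> * of_int j" if "i < j" for i j :: int
  proof -
    have "\<epsilon> * (of_int i + 1) \<le> \<epsilon> * of_int j" using that \<open>\<epsilon> > 0\<close> by (intro mult_left_mono) auto
    then show ?thesis by (simp add: algebra_simps)
  qed
  have "\<bar>\<epsilon> * real (card {M..min N k}) + \<epsilon> * of_int M - v x\<bar> \<le> 2 * \<epsilon>"
  proof (cases "M \<le> min N k")
    case True
    then have "\<epsilon> * real (card {M..min N k}) + \<epsilon> * of_int M = \<epsilon> * of_int (min N k) + \<epsilon>"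
      by (simp add: algebra_simps del: min_less_iff_conj min.bounded_iff)
    moreover have "\<epsilon> * of_int (min N k) \<le> v x"
      by (subst reached) simp
    moreover have "v x - \<epsilon> < \<epsilon> * of_int (min N k) + \<epsilon>"
      using N k \<open>\<epsilon> > 0\<close> by (auto simp: min_def)
    ultimately show ?thesis using \<open>\<epsilon> > 0\<close> by linarith
  next
    case False
    then consider "N < M" | "k < M" by linarith
    then have "v x - \<epsilon> < \<epsilon> * of_int M"
      using mult[of N M] mult[of k M] N k \<open>\<epsilon> > 0\<close> by cases linarith+
    with False M \<open>\<epsilon> > 0\<close> show ?thesis by simp
  qed
  then show ?thesis by (simp only: sum flip: M_def N_def)
qed

section \<open>Sharpening the layers\<close>

text \<open>For \<open>\<bar>s\<bar> \<le> \<epsilon>\<close> two numbers in \<open>[0, 1]\<close> differ by at most \<open>1\<close>. For \<open>\<bar>s\<bar> > \<epsilon>\<close> the width \<open>\<epsilon>\<close> of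
  this window cancels against the scale \<open>\<epsilon> * d\<close>, so monotonicity compares \<open>\<phi>\<close> with its value at
  \<open>\<plusminus>1 / d\<close>, which depends on neither \<open>s\<close> nor \<open>\<epsilon>\<close>.\<close>

lemma profile_step_error:
  fixes \<phi> :: "real \<Rightarrow> real"
  assumes "mono \<phi>" and "\<And>z. 0 \<le> \<phi> z" "\<And>z. \<phi> z \<le> 1" and "\<epsilon> > 0" "d > 0"
  shows "\<bar>\<phi> (s / (\<epsilon> * d)) - of_bool (0 \<le> s)\<bar>
    \<le> of_bool (\<bar>s\<bar> \<le> \<epsilon>) + (\<phi> (- (1 / d)) + (1 - \<phi> (1 / d)))"
proof -
  have tails: "0 \<le> \<phi> (- (1 / d))" "\<phi> (1 / d) \<le> 1" using assms(2,3) by auto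
  consider "\<bar>s\<bar> \<le> \<epsilon>" | "s > \<epsilon>" | "s < - \<epsilon>" by linarith
  then show ?thesis
  proof cases
    case 1
    then show ?thesis using tails assms(2,3)[of "s / (\<epsilon> * d)"] by auto
  next
    case 2
    then have "\<phi> (1 / d) \<le> \<phi> (s / (\<epsilon> * d))"
      using \<open>\<epsilon> > 0\<close> \<open>d > 0\<close> by (intro monoD[OF \<open>mono \<phi>\<close>]) (simp add: field_simps)
    then show ?thesis using 2 tails assms(3)[of "s / (\<epsilon> * d)"] \<open>\<epsilon> > 0\<close> by auto
  next
    case 3
    then have "\<phi> (s / (\<epsilon> * d)) \<le> \<phi> (- (1 / d))"
      using \<open>\<epsilon> > 0\<close> \<open>d > 0\<close> by (intro monoD[OF \<open>mono \<phi>\<close>]) (simp add: field_simps)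
    then show ?thesis using 3 tails assms(2)[of "s / (\<epsilon> * d)"] \<open>\<epsilon> > 0\<close> by auto
  qed
qed

lemma layer_sum_approx:
  fixes v \<phi> :: "real \<Rightarrow> real"
  assumes "mono v" "bounded (range v)"
    and "L \<ge> 0" and Lip: "\<And>x y. \<bar>v x - v y\<bar> \<le> L * \<bar>x - y\<bar>"
    and "mono \<phi>" "\<And>z. 0 \<le> \<phi> z" "\<And>z. \<phi> z \<le> 1"
    and "\<epsilon> > 0" "d > 0"
  shows "\<bar>(\<Sum>i\<in>{M_idx v \<epsilon>..N_idx v \<epsilon>}. \<epsilon> * \<phi> ((x - level_pt v \<epsilon> i) / (\<epsilon> * d)))
            + \<epsilon> * of_int (M_idx v \<epsilon>) - v x\<bar>
    \<le> \<epsilon> * (2 * L + 3) + (Sup (range v) - Inf (range v)) * (\<phi> (- (1 / d)) + (1 - \<phi> (1 / d)))"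
proof -
  define I where "I = {M_idx v \<epsilon>..N_idx v \<epsilon>}"
  define p where "p = level_pt v \<epsilon>"
  define tail where "tail = \<phi> (- (1 / d)) + (1 - \<phi> (1 / d))"
  have "tail \<ge> 0" unfolding tail_def using assms(6)[of "- (1 / d)"] assms(7)[of "1 / d"] by simp
  have "L-lipschitz_on UNIV v"
    using Lip \<open>L \<ge> 0\<close> by (intro lipschitz_onI) (auto simp: dist_real_def)
  then have cont: "continuous_on UNIV v" by (rule lipschitz_on_continuous_on)
  have level: "v (p i) = \<epsilon> * of_int i" "0 \<le> x - p i \<longleftrightarrow> \<epsilon> * of_int i \<le> v x" if i: "i \<in> I" for i
  proof -
    obtain a b where "v a < \<epsilon> * of_int i" "\<epsilon> * of_int i < v b"
      using index_range_levels_crossed[OF \<open>\<epsilon> > 0\<close> i[unfolded I_def]] .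
    then show "v (p i) = \<epsilon> * of_int i" "0 \<le> x - p i \<longleftrightarrow> \<epsilon> * of_int i \<le> v x"
      using level_pt_attained(1)[OF cont \<open>mono v\<close>] level_pt_le_iff[OF cont \<open>mono v\<close>]
      unfolding p_def by simp_all
  qed
  have near: "real (card {i\<in>I. \<bar>x - p i\<bar> \<le> \<epsilon>}) \<le> 2 * L + 1"
  proof (rule card_integers_near)
    fix i
    assume i: "i \<in> {i\<in>I. \<bar>x - p i\<bar> \<le> \<epsilon>}"
    have "\<bar>\<epsilon> * of_int i - v x\<bar> \<le> L * \<bar>p i - x\<bar>"
      using Lip[of "p i" x] level(1) i by simp
    also have "\<dots> \<le> L * \<epsilon>"
      using i \<open>L \<ge> 0\<close> by (intro mult_left_mono) auto
    finally have "\<epsilon> * \<bar>of_int i - v x / \<epsilon>\<bar> \<le> \<epsilon> * L"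
      using \<open>\<epsilon> > 0\<close> by (simp add: abs_mult_pos' right_diff_distrib mult.commute)
    then show "\<bar>of_int i - v x / \<epsilon>\<bar> \<le> L" using \<open>\<epsilon> > 0\<close> by simp
  next
    show "finite {i\<in>I. \<bar>x - p i\<bar> \<le> \<epsilon>}"
      unfolding I_def by (intro finite_Collect_conjI disjI1) simp
  qed (rule \<open>L \<ge> 0\<close>)
  let ?layers = "\<Sum>i\<in>I. \<epsilon> * \<phi> ((x - p i) / (\<epsilon> * d))"
  let ?steps = "\<Sum>i\<in>I. \<epsilon> * of_bool (\<epsilon> * of_int i \<le> v x)"
  have "?steps = (\<Sum>i\<in>I. \<epsilon> * of_bool (0 \<le> x - p i))"
    by (rule sum.cong) (simp_all only: level(2))
  then have "\<bar>?layers - ?steps\<bar>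
      = \<bar>\<Sum>i\<in>I. \<epsilon> * (\<phi> ((x - p i) / (\<epsilon> * d)) - of_bool (0 \<le> x - p i))\<bar>"
    by (simp only: sum_subtractf right_diff_distrib)
  also have "\<dots> \<le> (\<Sum>i\<in>I. \<bar>\<epsilon> * (\<phi> ((x - p i) / (\<epsilon> * d)) - of_bool (0 \<le> x - p i))\<bar>)"
    by (rule sum_abs)
  also have "\<dots> = (\<Sum>i\<in>I. \<epsilon> * \<bar>\<phi> ((x - p i) / (\<epsilon> * d)) - of_bool (0 \<le> x - p i)\<bar>)"
    using \<open>\<epsilon> > 0\<close> by (simp only: abs_mult abs_of_pos)
  also have "\<dots> \<le> (\<Sum>i\<in>I. \<epsilon> * (of_bool (\<bar>x - p i\<bar> \<le> \<epsilon>) + tail))"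
    unfolding tail_def using assms(5-9)
    by (intro sum_mono mult_left_mono profile_step_error) auto
  also have "\<dots> = \<epsilon> * real (card {i\<in>I. \<bar>x - p i\<bar> \<le> \<epsilon>}) + \<epsilon> * real (card I) * tail"
    by (simp add: I_def sum.distrib distrib_left Int_def flip: sum_distrib_left)
  also have "\<dots> \<le> \<epsilon> * (2 * L + 1) + (Sup (range v) - Inf (range v)) * tail"
    using near \<open>\<epsilon> > 0\<close> \<open>tail \<ge> 0\<close> weighted_card_index_range[OF \<open>\<epsilon> > 0\<close> assms(2)]
    by (intro add_mono mult_left_mono mult_right_mono) (auto simp: I_def)
  finally have "\<bar>?layers - ?steps\<bar>
    \<le> \<epsilon> * (2 * L + 1) + (Sup (range v) - Inf (range v)) * tail" .
  moreover have "\<bar>?steps + \<epsilon> * of_int (M_idx v \<epsilon>) - v x\<bar> \<le> 2 * \<epsilon>"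
    unfolding I_def using assms(2) \<open>\<epsilon> > 0\<close> by (rule staircase_approx[rotated])
  moreover have "\<epsilon> * (2 * L + 3) = \<epsilon> * (2 * L + 1) + 2 * \<epsilon>" by (simp add: algebra_simps)
  ultimately show ?thesis unfolding I_def p_def tail_def by linarith
qed

theorem proposition4p12:
  fixes v W \<phi> \<delta> :: "real \<Rightarrow> real" and \<beta> :: real
  assumes "0 < \<beta>" and "\<beta> < 1" and "periodic_potential \<beta> W"
    and "v \<in> Holder_space 1 1" and "mono v" and "\<not> v constant_on UNIV"
    and "\<And>\<epsilon>. 0 < \<epsilon> \<Longrightarrow> \<epsilon> < 1 \<Longrightarrow> \<delta> \<epsilon> > 0"
    and "(\<delta> \<longlongrightarrow> 0) (at_right 0)"
    and "layer_solution W \<phi>"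
  shows "\<exists>err :: real \<Rightarrow> real. (err \<longlongrightarrow> 0) (at_right 0) \<and>
    (\<forall>\<epsilon> x. 0 < \<epsilon> \<longrightarrow> \<epsilon> < 1 \<longrightarrow>
      \<bar>(\<Sum>i\<in>{M_idx v \<epsilon>..N_idx v \<epsilon>}. \<epsilon> * \<phi> ((x - level_pt v \<epsilon> i) / (\<epsilon> * \<delta> \<epsilon>)))
        + \<epsilon> * of_int (M_idx v \<epsilon>) - v x\<bar> \<le> err \<epsilon>)"
proof -
  have bdd: "bounded (range v)" using assms(4) by (rule Holder_space_bounded)
  obtain L where L: "L \<ge> 0" "\<And>x y. \<bar>v x - v y\<bar> \<le> L * \<bar>x - y\<bar>"
    using Holder_space_Suc_Lipschitz[of v 0 1] assms(4) by auto
  have mono: "mono \<phi>" using assms(9) by (rule layer_solution_mono)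
  have lim: "(\<phi> \<longlongrightarrow> 0) at_bot" "(\<phi> \<longlongrightarrow> 1) at_top"
    using assms(9) by (auto simp: layer_solution_def)
  define err where "err \<epsilon> = \<epsilon> * (2 * L + 3)
      + (Sup (range v) - Inf (range v)) * (\<phi> (- (1 / \<delta> \<epsilon>)) + (1 - \<phi> (1 / \<delta> \<epsilon>)))" for \<epsilon>
  have "\<forall>\<^sub>F \<epsilon> in at_right 0. \<delta> \<epsilon> > 0"
    using eventually_at_right_less[of "0::real"] eventually_at_right_real[of 0 1, OF zero_less_one]
    by eventually_elim (use assms(7) in auto)
  then have "filterlim \<delta> (at_right 0) (at_right 0)"
    using assms(8) by (auto simp: filterlim_at elim: eventually_mono)
  then have top: "filterlim (\<lambda>\<epsilon>. 1 / \<delta> \<epsilon>) at_top (at_right 0)"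
    using filterlim_compose[OF filterlim_inverse_at_top_right]
    by (simp add: inverse_eq_divide)
  then have bot: "filterlim (\<lambda>\<epsilon>. - (1 / \<delta> \<epsilon>)) at_bot (at_right 0)"
    by (simp add: filterlim_uminus_at_top)
  have "(err \<longlongrightarrow> 0 * (2 * L + 3) + (Sup (range v) - Inf (range v)) * (0 + (1 - 1))) (at_right 0)"
    unfolding err_def
    by (intro tendsto_intros filterlim_compose[OF lim(1) bot] filterlim_compose[OF lim(2) top])
  moreover have "\<bar>(\<Sum>i\<in>{M_idx v \<epsilon>..N_idx v \<epsilon>}. \<epsilon> * \<phi> ((x - level_pt v \<epsilon> i) / (\<epsilon> * \<delta> \<epsilon>)))
        + \<epsilon> * of_int (M_idx v \<epsilon>) - v x\<bar> \<le> err \<epsilon>" if "0 < \<epsilon>" "\<epsilon> < 1" for \<epsilon> x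
    unfolding err_def
    by (rule layer_sum_approx)
      (use assms(5,7) bdd L mono mono_ge_limit_at_bot[OF mono lim(1)]
         mono_le_limit_at_top[OF mono lim(2)] that in auto)
  ultimately show ?thesis by auto
qed

end
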